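(* Let $\alpha\in\mathbb{C}$, $0<\operatorname{Re}(\alpha)<1$, and let $n\ge 3$ be an integer. Then the vector $[1,\ldots,1]^\top$ is an eigenvector of the matrix $L_{\alpha,n}$ associated to the eigenvalue $\lambda_{\alpha,n,1}=0$. For every $j$, $2\le j\le n$, and every $k$, $1\le k\le n$, define $$v_{\alpha,n,j,k}=\sin(k\vartheta_{\alpha,n,j})-(1-\overline{\alpha})\sin((k-1)\vartheta_{\alpha,n,j})+\overline{\alpha}\sin((n-k)\vartheta_{\alpha,n,j}).$$ Then the vector $v_{\alpha,n,j}=[v_{\alpha,n,j,k}]_{k=1}^n$ is an eigenvector of $L_{\alpha,n}$ associated to $\lambda_{\alpha,n,j}$. Moreover, if $j$ is odd, then $$\|v_{\alpha,n,j}\|_2=|1-\alpha|\sqrt{\frac{n}{2}\lambda_{\alpha,n,j}}.$$ If $j$ is even, then $$\|v_{\alpha,n,j}\|_2=\sqrt{n\,\nu_\alpha(\vartheta_{\alpha,n,j})}+O_\alpha\left(\frac{1}{\sqrt n}\right),$$ with $O_\alpha(1/\sqrt n)$ uniform in $j$; that is, there is a constant $C_\alpha>0$ depending only on $\alpha$ such that for all integers $n\ge3$ and all even $j$ with $2\le j\le n$, $\left|\|v_{\alpha,n,j}\|_2-\sqrt{n\,\nu_\alpha(\vartheta_{\alpha,n,j})}\right|\le C_\alpha/\sqrt n$.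
   Context: For $\alpha\in\mathbb{C}$ and an integer $n\ge3$, $L_{\alpha,n}$ is the complex $n\times n$ matrix with entries: $(1,1)$ entry $1+\overline{\alpha}$; $(n,n)$ entry $1+\alpha$; $(k,k)$ entries $2$ for $2\le k\le n-1$; $(k,k+1)$ and $(k+1,k)$ entries $-1$ for $1\le k\le n-1$; $(1,n)$ entry $-\overline{\alpha}$; $(n,1)$ entry $-\alpha$; all other entries $0$. Its characteristic polynomial coincides with that of the real symmetric matrix $L_{\operatorname{Re}(\alpha),n}$, so its eigenvalues, counted with algebraic multiplicity, are real and are denoted $\lambda_{\alpha,n,1}\le\dots\le\lambda_{\alpha,n,n}$; for $0<\operatorname{Re}(\alpha)<1$ they belong to $[0,4]$. Let $g(x)=2-2\cos x=4\sin^2(x/2)$ for real $x$; $g$ maps $[0,\pi]$ bijectively onto $[0,4]$, and $\vartheta_{\alpha,n,j}$ is the unique number in $[0,\pi]$ with $g(\vartheta_{\alpha,n,j})=\lambda_{\alpha,n,j}$. Put $\varkappa_\alpha=\frac{\operatorname{Re}(\alpha)}{1-\operatorname{Re}(\alpha)}$. The function $\eta_\alpha\colon[0,\pi]\to\mathbb{R}$ is $\eta_\alpha(x)=2\arctan\left(\varkappa_\alpha\cot\frac{x}{2}\right)$ for $0<x\le\pi$, with $\eta_\alpha(0)=\pi$. For $x\in[0,\pi]$, $$\nu_\alpha(x)=\frac{1-\operatorname{Re}(\alpha)}{2}g(x)-\frac{\operatorname{Re}(\alpha)}{2}g(\eta_\alpha(x))+\frac{\operatorname{Re}(\alpha)-|\alpha|^2}{2}g(x-\eta_\alpha(x))+2|\alpha|^2.$$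 $\|\cdot\|_2$ is the Euclidean norm on $\mathbb{C}^n$. *)

theory Defs
  imports "HOL-Analysis.L2_Norm" "Jordan_Normal_Form.Char_Poly"
begin

text \<open>
  Indices are 1-based (\<open>1 \<le> j, k \<le> n\<close>) in all the definitions below; the library's vectors and
  matrices are 0-based, so the shift by one is made only where these are built.
\<close>

definition lap_entry :: "complex \<Rightarrow> nat \<Rightarrow> nat \<Rightarrow> nat \<Rightarrow> complex" where
  "lap_entry \<alpha> n j k =
    (if j = 1 \<and> k = 1 then 1 + cnj \<alpha>
     else if j = n \<and> k = n then 1 + \<alpha>
     else if j = k then 2
     else if k = j + 1 \<or> j = k + 1 then - 1
     else if j = 1 \<and> k = n then - cnj \<alpha>
     else if j = n \<and> k = 1 then - \<alpha>
     else 0)"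

definition lap_mat :: "complex \<Rightarrow> nat \<Rightarrow> complex mat" where
  "lap_mat \<alpha> n = mat n n (\<lambda>(j, k). lap_entry \<alpha> n (j + 1) (k + 1))"

text \<open>
  The eigenvalues with algebraic multiplicity, i.e. the roots of the characteristic polynomial
  with multiplicity, listed in nondecreasing order. They are all real, so that such a list of
  reals exists, and it is unique and has length \<open>n\<close>.
\<close>

definition lap_eigenvalues :: "complex \<Rightarrow> nat \<Rightarrow> real list" where
  "lap_eigenvalues \<alpha> n =
    (THE xs. sorted xs \<and> char_poly (lap_mat \<alpha> n) = (\<Prod>x\<leftarrow>xs. [:- complex_of_real x, 1:]))"

definition lap_eigenvalue :: "complex \<Rightarrow> nat \<Rightarrow> nat \<Rightarrow> real" where
  "lap_eigenvalue \<alpha> n j = lap_eigenvalues \<alpha> n ! (j - 1)"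

definition g :: "real \<Rightarrow> real" where
  "g x = 2 - 2 * cos x"

definition lap_theta :: "complex \<Rightarrow> nat \<Rightarrow> nat \<Rightarrow> real" where
  "lap_theta \<alpha> n j = (THE x. 0 \<le> x \<and> x \<le> pi \<and> g x = lap_eigenvalue \<alpha> n j)"

definition kappa :: "complex \<Rightarrow> real" where
  "kappa \<alpha> = Re \<alpha> / (1 - Re \<alpha>)"

text \<open>The functions \<open>eta \<alpha>\<close> and \<open>nu \<alpha>\<close> are only meant on the interval \<open>{0..pi}\<close>.\<close>

definition eta :: "complex \<Rightarrow> real \<Rightarrow> real" where
  "eta \<alpha> x = (if x = 0 then pi else 2 * arctan (kappa \<alpha> * cot (x / 2)))"

definition nu :: "complex \<Rightarrow> real \<Rightarrow> real" where
  "nu \<alpha> x = (1 - Re \<alpha>) / 2 * g x - Re \<alpha> / 2 * g (eta \<alpha> x)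
     + (Re \<alpha> - (cmod \<alpha>)\<^sup>2) / 2 * g (x - eta \<alpha> x) + 2 * (cmod \<alpha>)\<^sup>2"

definition eigvec_entry :: "complex \<Rightarrow> nat \<Rightarrow> nat \<Rightarrow> nat \<Rightarrow> complex" where
  "eigvec_entry \<alpha> n j k =
     complex_of_real (sin (real k * lap_theta \<alpha> n j))
     - (1 - cnj \<alpha>) * complex_of_real (sin ((real k - 1) * lap_theta \<alpha> n j))
     + cnj \<alpha> * complex_of_real (sin ((real n - real k) * lap_theta \<alpha> n j))"

definition eigvec :: "complex \<Rightarrow> nat \<Rightarrow> nat \<Rightarrow> complex vec" where
  "eigvec \<alpha> n j = vec n (\<lambda>k. eigvec_entry \<alpha> n j (k + 1))"

definition norm2 :: "complex vec \<Rightarrow> real" where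
  "norm2 v = L2_set (\<lambda>k. cmod (v $ k)) {..<dim_vec v}"

end

theory Submission
  imports Defs
begin

text \<open>
  The vector \<open>v\<close> with \<open>v k = sin (k t) - (1 - cnj \<alpha>) sin ((k - 1) t) + cnj \<alpha> sin ((n - k) t)\<close> satisfies the
  three-term recurrence \<open>2 v k - v (k - 1) - v (k + 1) = g t * v k\<close> and the boundary condition
  from the first row identically; the last row reduces to \<open>sin (n t / 2) * secular \<alpha> n t = 0\<close>.
  The zeros of the first factor and, by the intermediate value theorem, sign changes of the second
  give one solution in each interval \<open>[(j - 1) \<pi> / n, j \<pi> / n)\<close>, hence \<open>n\<close> distinct
  eigenvalues. These must be all the roots of the characteristic polynomial, so no determinant is computed.

  For the norms, write \<open>v k\<close> as a combination of \<open>cis (k t)\<close> and \<open>cis (- k t)\<close>. Then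
  \<open>\<Sum>k. |v k|\<^sup>2\<close> differs from \<open>n\<close> times its mean value \<open>M\<close> by at most
  \<open>M * |sin (n t) / sin t|\<close>. For odd \<open>j\<close> this vanishes. For even \<open>j\<close> one has \<open>cis (n t) = - cis (eta \<alpha> t)\<close>,
  which gives \<open>M = nu \<alpha> t\<close> and a bound on \<open>|sin (n t) / sin t|\<close> that is uniform in \<open>n\<close> and \<open>j\<close>. As the
  error is proportional to \<open>M\<close>, taking square roots is harmless even though \<open>nu \<alpha>\<close> vanishes at \<open>0\<close>.
\<close>

section \<open>Trigonometric ansatz and its boundary conditions\<close>

text \<open>The angle is free and the index \<open>x\<close> is real, so that virtual values at
  \<open>0\<close> and \<open>n + 1\<close> exist; through them the first and last rows take the
  form of interior rows.\<close>

definition trig_entry :: "complex \<Rightarrow> nat \<Rightarrow> real \<Rightarrow> real \<Rightarrow> complex" where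
  "trig_entry \<alpha> n t x = complex_of_real (sin (x * t))
     - (1 - cnj \<alpha>) * complex_of_real (sin ((x - 1) * t))
     + cnj \<alpha> * complex_of_real (sin ((real n - x) * t))"

text \<open>For \<open>0 < Re \<alpha> < 1\<close> and \<open>0 < t < pi\<close> this is a positive
  multiple of \<open>cos ((n * t - eta \<alpha> t) / 2)\<close>. The form without a quotient is
  continuous everywhere.\<close>

definition secular :: "complex \<Rightarrow> nat \<Rightarrow> real \<Rightarrow> real" where
  "secular \<alpha> n t = (1 - Re \<alpha>) * cos (real n * t / 2) * sin (t / 2)
     + Re \<alpha> * sin (real n * t / 2) * cos (t / 2)"

text \<open>Each of the three terms is a sine whose argument is affine in \<open>x\<close> with
  slope \<open>t\<close> or \<open>- t\<close>, so the sum formula \<open>shift\<close> applies to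
  each separately.\<close>

lemma trig_entry_recurrence:
  "2 * trig_entry \<alpha> n t x - trig_entry \<alpha> n t (x - 1) - trig_entry \<alpha> n t (x + 1)
    = of_real (g t) * trig_entry \<alpha> n t x"
proof -
  have shift: "sin (a - t) + sin (a + t) = 2 * cos t * sin a" for a
    by (simp add: sin_add sin_diff)
  have r: "complex_of_real (sin (a - t)) = 2 * of_real (cos t) * of_real (sin a) - of_real (sin (a + t))" for a
    using arg_cong[OF shift[of a], of complex_of_real] by (simp add: algebra_simps)
  have a: "(x - 1 - 1) * t = (x - 1) * t - t" "x * t = (x - 1) * t + t"
      "(x + 1) * t = x * t + t" "(x + 1 - 1) * t = (x - 1) * t + t"
      "(real n - (x + 1)) * t = (real n - x) * t - t" "(real n - (x - 1)) * t = (real n - x) * t + t"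
    by (simp_all add: algebra_simps)
  have b: "(x - 1) * t = x * t - t" by (simp add: algebra_simps)
  show ?thesis
    using r[of "x * t"] r[of "(x - 1) * t"] r[of "(real n - x) * t"]
    unfolding trig_entry_def g_def
    by (simp only: a(1,3,4,5,6)) (simp add: algebra_simps flip: b a(2))
qed

text \<open>With this virtual value \<open>v 0\<close>, row 1 applied to \<open>v\<close> becomes
  \<open>2 * v 1 - v 0 - v 2\<close>.\<close>

lemma trig_entry_left:
  "trig_entry \<alpha> n t 0 = (1 - cnj \<alpha>) * trig_entry \<alpha> n t 1 + cnj \<alpha> * trig_entry \<alpha> n t n"
  by (simp add: trig_entry_def algebra_simps)

text \<open>The left side is \<open>v (n + 1) - (1 - \<alpha>) * v n - \<alpha> * v 1\<close>, the
  defect in the last row; \<open>Im \<alpha>\<close> cancels from it. Passing to half angles factors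
  it.\<close>

lemma secular_identity:
  "sin ((real n + 1) * t) - 2 * (1 - Re \<alpha>) * sin (real n * t)
     + (1 - 2 * Re \<alpha>) * sin ((real n - 1) * t) - 2 * Re \<alpha> * sin t
   = - 8 * sin (t / 2) * sin (real n * t / 2) * secular \<alpha> n t"
proof -
  define x y where "x = t / 2" and "y = real n * t / 2"
  have e: "(real n + 1) * t = 2 * y + 2 * x" "(real n - 1) * t = 2 * y - 2 * x" "real n * t = 2 * y" "t = 2 * x"
    "t / 2 = x" "real n * t / 2 = y"
    by (simp_all add: x_def y_def algebra_simps)
  show ?thesis
    unfolding secular_def e(1,2,5,6) unfolding e(3) unfolding e(4)
    unfolding sin_add sin_diff unfolding sin_double cos_double_sin
    by (simp add: algebra_simps power2_eq_square)
qed

lemma trig_entry_right: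
  assumes "sin (real n * t / 2) * secular \<alpha> n t = 0"
  shows "trig_entry \<alpha> n t (real n + 1) = (1 - \<alpha>) * trig_entry \<alpha> n t n + \<alpha> * trig_entry \<alpha> n t 1"
proof -
  have "sin ((real n + 1) * t) - 2 * (1 - Re \<alpha>) * sin (real n * t)
     + (1 - 2 * Re \<alpha>) * sin ((real n - 1) * t) - 2 * Re \<alpha> * sin t = 0"
    using assms unfolding secular_identity by auto
  then show ?thesis
    by (simp add: trig_entry_def complex_eq_iff algebra_simps)
qed

text \<open>Vanishing at both ends would force \<open>Im \<alpha> = 0\<close> and then, after
  elimination of \<open>sin (n * t)\<close> and \<open>cos (n * t)\<close>,
  \<open>cos t = 1\<close>.\<close>

lemma trig_entry_nonzero:
  assumes "0 < Re \<alpha>" "Re \<alpha> < 1" "0 < t" "t < pi"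
  shows "trig_entry \<alpha> n t 1 \<noteq> 0 \<or> trig_entry \<alpha> n t n \<noteq> 0"
proof (rule ccontr)
  assume "\<not> ?thesis"
  then have 1: "trig_entry \<alpha> n t 1 = 0" and 2: "trig_entry \<alpha> n t n = 0" by auto
  have st: "sin t > 0" using assms by (simp add: sin_gt_zero)
  define p q where "p = sin ((real n - 1) * t)" and "q = sin (real n * t)"
  have r: "sin t + Re \<alpha> * p = 0" and i: "Im \<alpha> * p = 0"
    using 1 by (auto simp: trig_entry_def complex_eq_iff p_def)
  have "p \<noteq> 0" using r st by auto
  then have "Im \<alpha> = 0" using i by simp
  then have q: "q = (1 - Re \<alpha>) * p"
    using 2 by (auto simp: trig_entry_def complex_eq_iff p_def q_def)
  have p: "p = q * cos t - cos (real n * t) * sin t"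
    unfolding p_def q_def by (simp add: left_diff_distrib sin_diff)
  have u: "q\<^sup>2 + (cos (real n * t))\<^sup>2 = 1" "(sin t)\<^sup>2 + (cos t)\<^sup>2 = 1" by (simp_all add: q_def)
  have "p * (1 - (1 - Re \<alpha>) * cos t - Re \<alpha> * cos (real n * t)) = 0"
  proof -
    have s: "sin t = - Re \<alpha> * p" using r by simp
    show ?thesis using p unfolding q s by (simp add: algebra_simps)
  qed
  then have c: "Re \<alpha> * cos (real n * t) = 1 - (1 - Re \<alpha>) * cos t"
    using \<open>p \<noteq> 0\<close> by simp
  \<comment> \<open>The Pythagorean identity for the angle \<open>n * t\<close>, scaled by
    \<open>(Re \<alpha>)\<^sup>2\<close>, turns into an equation in \<open>cos t\<close>
    alone.\<close>
  have "(1 - Re \<alpha>)\<^sup>2 * (Re \<alpha> * p)\<^sup>2 + (Re \<alpha> * cos (real n * t))\<^sup>2 = (Re \<alpha>)\<^sup>2 * (q\<^sup>2 + (cos (real n * t))\<^sup>2)"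
    unfolding q by (simp add: power_mult_distrib distrib_left mult_ac)
  moreover have "(Re \<alpha> * p)\<^sup>2 = 1 - (cos t)\<^sup>2"
  proof -
    have "Re \<alpha> * p = - sin t" using r by simp
    then show ?thesis using u(2) by (simp add: eq_diff_eq)
  qed
  ultimately have "(1 - Re \<alpha>)\<^sup>2 * (1 - (cos t)\<^sup>2) + (1 - (1 - Re \<alpha>) * cos t)\<^sup>2 = (Re \<alpha>)\<^sup>2"
    unfolding u(1) c by simp
  then have "2 * (1 - Re \<alpha>) * (1 - cos t) = 0"
    by (simp add: algebra_simps power2_eq_square)
  then have "cos t = 1" using assms by simp
  then show False using u(2) st by simp
qed


section \<open>Rows of the matrix and its eigenvectors\<close>

lemma lap_entry_row_sum:
  assumes "n \<ge> 3" "1 \<le> i" "i \<le> n"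
  shows "(\<Sum>k=1..n. lap_entry \<alpha> n i k * f k) =
    (if i = 1 then (1 + cnj \<alpha>) * f 1 - f 2 - cnj \<alpha> * f n
     else if i = n then (1 + \<alpha>) * f n - f (n - 1) - \<alpha> * f 1
     else 2 * f i - f (i - 1) - f (i + 1))"
proof -
  have support: "(\<Sum>k=1..n. lap_entry \<alpha> n i k * f k) = (\<Sum>k\<in>S. lap_entry \<alpha> n i k * f k)"
    if "S \<subseteq> {1..n}" "\<And>k. k \<in> {1..n} - S \<Longrightarrow> lap_entry \<alpha> n i k = 0" for S
    using that by (intro sum.mono_neutral_right) auto
  consider "i = 1" | "i = n" "i \<noteq> 1" | m where "i = Suc (Suc m)" "i < n"
    using assms by (metis One_nat_def le_neq_implies_less less_eq_Suc_le not0_implies_Suc not_less_zero)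
  then show ?thesis
  proof cases
    case 1
    have "(\<Sum>k=1..n. lap_entry \<alpha> n i k * f k) = (\<Sum>k\<in>{1, 2, n}. lap_entry \<alpha> n i k * f k)"
      using assms 1 by (intro support) (auto simp: lap_entry_def)
    then show ?thesis using assms 1 by (simp add: lap_entry_def)
  next
    case 2
    obtain m where "n = 3 + m" using assms(1) le_Suc_ex by blast
    then have m: "n = Suc (Suc (Suc m))" by simp
    have "(\<Sum>k=1..n. lap_entry \<alpha> n i k * f k) = (\<Sum>k\<in>{1, n - 1, n}. lap_entry \<alpha> n i k * f k)"
      using 2 m by (intro support) (auto simp: lap_entry_def)
    then show ?thesis using 2 m by (simp add: lap_entry_def)
  next
    case 3
    have "(\<Sum>k=1..n. lap_entry \<alpha> n i k * f k) = (\<Sum>k\<in>{i - 1, i, i + 1}. lap_entry \<alpha> n i k * f k)"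
      using 3 by (intro support) (auto simp: lap_entry_def)
    then show ?thesis using 3 by (simp add: lap_entry_def)
  qed
qed

lemma lap_mat_mult_vec_index:
  assumes "i < n"
  shows "(lap_mat \<alpha> n *\<^sub>v vec n (\<lambda>k. f (k + 1))) $ i = (\<Sum>k=1..n. lap_entry \<alpha> n (i + 1) k * f k)"
proof -
  have "(lap_mat \<alpha> n *\<^sub>v vec n (\<lambda>k. f (k + 1))) $ i = (\<Sum>k<n. lap_entry \<alpha> n (i + 1) (k + 1) * f (k + 1))"
    using assms by (simp add: lap_mat_def scalar_prod_def atLeast0LessThan)
  also have "\<dots> = (\<Sum>k=1..n. lap_entry \<alpha> n (i + 1) k * f k)"
    by (rule sum.reindex_bij_witness[of _ "\<lambda>k. k - 1" "\<lambda>k. k + 1"]) auto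
  finally show ?thesis .
qed

lemma eigenvector_lap_matI:
  assumes "n \<ge> 3" and "\<And>i. 1 \<le> i \<Longrightarrow> i \<le> n \<Longrightarrow> (\<Sum>k=1..n. lap_entry \<alpha> n i k * f k) = c * f i"
    and "1 \<le> m" "m \<le> n" "f m \<noteq> 0"
  shows "eigenvector (lap_mat \<alpha> n) (vec n (\<lambda>k. f (k + 1))) c"
  unfolding eigenvector_def
proof (intro conjI)
  let ?v = "vec n (\<lambda>k. f (k + 1))"
  have d: "dim_row (lap_mat \<alpha> n) = n" by (simp add: lap_mat_def)
  show "?v \<in> carrier_vec (dim_row (lap_mat \<alpha> n))" unfolding d by simp
  obtain k where "m = Suc k" using assms(3) by (cases m) auto
  then have "?v $ (m - 1) = f m" using assms(4) by simp
  moreover have "m - 1 < n" using assms by auto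
  ultimately show "?v \<noteq> 0\<^sub>v (dim_row (lap_mat \<alpha> n))"
    unfolding d using assms(5) by (metis index_zero_vec(1))
  show "lap_mat \<alpha> n *\<^sub>v ?v = c \<cdot>\<^sub>v ?v"
  proof (rule eq_vecI)
    fix i assume "i < dim_vec (c \<cdot>\<^sub>v ?v)"
    then have "i < n" by simp
    then show "(lap_mat \<alpha> n *\<^sub>v ?v) $ i = (c \<cdot>\<^sub>v ?v) $ i"
      unfolding lap_mat_mult_vec_index[OF \<open>i < n\<close>] by (subst assms(2)) auto
  qed (simp add: d)
qed

lemma eigenvector_ones:
  assumes "n \<ge> 3"
  shows "eigenvector (lap_mat \<alpha> n) (vec n (\<lambda>k. 1)) 0"
proof -
  have "(\<Sum>k=1..n. lap_entry \<alpha> n i k * 1) = 0 * 1" if "1 \<le> i" "i \<le> n" for i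
    unfolding lap_entry_row_sum[OF assms that, of \<alpha> "\<lambda>_. 1"] by simp
  from eigenvector_lap_matI[OF assms this, of 1] show ?thesis using assms by simp
qed

text \<open>The interior rows are the recurrence itself; the first and last rows reduce to it
  through the virtual values at \<open>0\<close> and \<open>n + 1\<close>.\<close>

lemma eigenvector_trig_entry:
  assumes "0 < Re \<alpha>" "Re \<alpha> < 1" "n \<ge> 3" "0 < t" "t < pi"
    and "sin (real n * t / 2) * secular \<alpha> n t = 0"
  shows "eigenvector (lap_mat \<alpha> n) (vec n (\<lambda>k. trig_entry \<alpha> n t (real (k + 1)))) (of_real (g t))"
proof -
  let ?h = "trig_entry \<alpha> n t"
  obtain m where m: "1 \<le> m" "m \<le> n" "?h (real m) \<noteq> 0"
    using trig_entry_nonzero[OF assms(1,2,4,5), of n] assms(3)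
    by (metis dual_order.trans le_refl of_nat_1 one_le_numeral)
  have "(\<Sum>k=1..n. lap_entry \<alpha> n i k * ?h (real k)) = of_real (g t) * ?h (real i)"
    if i: "1 \<le> i" "i \<le> n" for i
  proof -
    have i1: "real (i - 1) = real i - 1" "real (n - 1) = real n - 1" using i assms(3) by auto
    have rec: "of_real (g t) * ?h (real i) = 2 * ?h (real i) - ?h (real i - 1) - ?h (real i + 1)"
      by (simp only: trig_entry_recurrence)
    show ?thesis
      unfolding lap_entry_row_sum[OF assms(3) i] rec
      using trig_entry_left[of \<alpha> n t] trig_entry_right[OF assms(6)] assms(3) i i1
      by (auto simp: algebra_simps)
  qed
  from eigenvector_lap_matI[where f = "\<lambda>k. ?h (real k)", OF assms(3) this m]
  show ?thesis by (simp add: add.commute)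
qed

section \<open>Localization of the angles\<close>

text \<open>The intervals are half-open, hence disjoint, which later makes the \<open>n\<close>
  angles distinct.\<close>

lemma trig_angles_exist:
  assumes "0 < Re \<alpha>" "Re \<alpha> < 1" "n \<ge> 1" "1 \<le> j" "j \<le> n"
  shows "\<exists>t. (real j - 1) * pi / n \<le> t \<and> t < real j * pi / n \<and>
    (if odd j then t = (real j - 1) * pi / n else secular \<alpha> n t = 0)"
proof (cases "odd j")
  case True
  then show ?thesis
    using assms by (intro exI[of _ "(real j - 1) * pi / n"]) (auto simp: divide_strict_right_mono)
next
  case False
  then obtain m where j: "j = 2 * m" by auto
  then have m: "m \<ge> 1" using assms by simp
  define a b where "a = (real j - 1) * pi / n" and "b = real j * pi / n"
  have n: "real n > 0" using assms by simp
  have ab: "0 < a" "a < b" "b \<le> pi"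
    using m n assms(5) by (auto simp: a_def b_def j field_simps)
  have na: "real n * a / 2 = real m * pi - pi / 2" and nb: "real n * b / 2 = real m * pi"
    using n by (simp_all add: a_def b_def j field_simps)
  \<comment> \<open>At \<open>a\<close> the factor \<open>cos (n * t / 2)\<close> vanishes and at
    \<open>b\<close> the factor \<open>sin (n * t / 2)\<close>, so one term of
    \<open>secular\<close> survives at each end, with opposite signs.\<close>
  have sa: "secular \<alpha> n a = - ((-1) ^ m * (Re \<alpha> * cos (a / 2)))"
    unfolding secular_def na by (simp add: cos_diff sin_diff)
  have sb: "secular \<alpha> n b = (-1) ^ m * ((1 - Re \<alpha>) * sin (b / 2))"
    unfolding secular_def nb by simp
  have pos: "Re \<alpha> * cos (a / 2) > 0" "(1 - Re \<alpha>) * sin (b / 2) > 0"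
    using ab assms by (auto intro!: mult_pos_pos cos_gt_zero_pi sin_gt_zero)
  \<comment> \<open>The factor \<open>(-1) ^ m\<close> makes the sign change go from negative to
    positive for either parity of \<open>m\<close>.\<close>
  have "continuous_on {a..b} (\<lambda>t. (-1) ^ m * secular \<alpha> n t)"
    unfolding secular_def by (intro continuous_intros) auto
  moreover have "(-1) ^ m * secular \<alpha> n a \<le> 0" "0 \<le> (-1) ^ m * secular \<alpha> n b"
    using pos by (simp_all add: sa sb flip: mult.assoc power_add)
  ultimately obtain t where t: "a \<le> t" "t \<le> b" "(-1) ^ m * secular \<alpha> n t = 0"
    using IVT'[of "\<lambda>t. (-1) ^ m * secular \<alpha> n t" a 0 b] ab by auto
  then have "secular \<alpha> n t = 0" by simp
  moreover have "t \<noteq> b" using calculation sb pos by auto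
  ultimately show ?thesis using t ab False unfolding a_def b_def by (intro exI[of _ t]) auto
qed

section \<open>Exhausting the characteristic polynomial\<close>

text \<open>Linear factors are split off one by one; distinctness keeps the remaining roots in the
  cofactor.\<close>

lemma monic_eq_prod_distinct_roots:
  fixes p :: "'a::idom poly"
  assumes "monic p" "degree p = length xs" "distinct xs" "\<And>x. x \<in> set xs \<Longrightarrow> poly p x = 0"
  shows "p = (\<Prod>x\<leftarrow>xs. [:- x, 1:])"
  using assms
proof (induction xs arbitrary: p)
  case Nil
  then show ?case by (auto elim: degree_eq_zeroE)
next
  case (Cons x xs)
  then have "[:- x, 1:] dvd p" by (simp add: poly_eq_0_iff_dvd)
  then obtain q where q: "p = [:- x, 1:] * q" by blast
  have "q \<noteq> 0" using Cons.prems(1) q by auto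
  then have "degree q = length xs" using Cons.prems(2) unfolding q by (subst (asm) degree_mult_eq) auto
  moreover have "monic q" using Cons.prems(1) unfolding q lead_coeff_mult by simp
  moreover have "poly q y = 0" if "y \<in> set xs" for y
    using Cons.prems(3) Cons.prems(4)[of y] that unfolding q by auto
  ultimately have "q = (\<Prod>x\<leftarrow>xs. [:- x, 1:])" using Cons.IH Cons.prems(3) by simp
  then show ?case by (simp add: q)
qed

text \<open>As many distinct eigenvalues as the degree factor the characteristic polynomial
  completely. The remaining work is the uniqueness demanded by \<open>THE\<close>.\<close>

lemma lap_eigenvalues_eqI:
  assumes "sorted xs" "distinct xs" "length xs = n"
    and "\<And>x. x \<in> set xs \<Longrightarrow> eigenvalue (lap_mat \<alpha> n) (of_real x)"
  shows "lap_eigenvalues \<alpha> n = xs"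
proof -
  have A: "lap_mat \<alpha> n \<in> carrier_mat n n" by (simp add: lap_mat_def)
  let ?p = "char_poly (lap_mat \<alpha> n)"
  have deg: "degree ?p = n" and mon: "monic ?p" using degree_monic_char_poly[OF A] by auto
  have "?p = (\<Prod>x\<leftarrow>map complex_of_real xs. [:- x, 1:])"
    using mon assms eigenvalue_root_char_poly[OF A]
    by (intro monic_eq_prod_distinct_roots) (auto simp: deg distinct_map inj_on_def)
  then have p: "?p = (\<Prod>x\<leftarrow>xs. [:- complex_of_real x, 1:])" by (simp add: o_def)
  have roots: "poly (\<Prod>x\<leftarrow>ys. [:- complex_of_real x, 1:]) (of_real z) = 0 \<longleftrightarrow> z \<in> set ys" for ys z
    by (induction ys) auto
  have len: "degree (\<Prod>x\<leftarrow>ys. [:- complex_of_real x, 1:]) = length ys" for ys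
  proof (induction ys)
    case (Cons y ys)
    moreover have "(\<Prod>x\<leftarrow>ys. [:- complex_of_real x, 1:]) \<noteq> 0" by (auto simp: prod_list_zero_iff)
    ultimately show ?case by (simp add: degree_mult_eq del: mult_pCons_left)
  qed simp
  \<comment> \<open>A competing list has the same root set and, by degrees, the same length, so it
    has no repetitions either.\<close>
  have "ys = xs" if "sorted ys" "?p = (\<Prod>x\<leftarrow>ys. [:- complex_of_real x, 1:])" for ys
  proof -
    have "set ys = set xs" using roots[of ys] roots[of xs] p that by auto
    moreover have "length ys = length xs" using len[of ys] len[of xs] p that by auto
    ultimately have "distinct ys" using assms(2) by (metis card_distinct distinct_card)
    with \<open>set ys = set xs\<close> show ?thesis using that assms by (simp add: sorted_distinct_set_unique)
  qed
  then show ?thesis unfolding lap_eigenvalues_def using p assms(1) by blast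
qed


section \<open>Identification of the ordered eigenvalues and their angles\<close>

lemma g_strict_mono:
  assumes "0 \<le> x" "x < y" "y \<le> pi"
  shows "g x < g y"
  using cos_monotone_0_pi[OF assms] by (simp add: g_def)

lemma lap_theta_eqI:
  assumes "0 \<le> t" "t \<le> pi" "lap_eigenvalue \<alpha> n j = g t"
  shows "lap_theta \<alpha> n j = t"
  unfolding lap_theta_def
proof (rule the_equality)
  fix x assume "0 \<le> x \<and> x \<le> pi \<and> g x = lap_eigenvalue \<alpha> n j"
  then show "x = t" using assms g_strict_mono[of x t] g_strict_mono[of t x] by linarith
qed (use assms in auto)

text \<open>The angles increase with \<open>j\<close> and \<open>g\<close> is strictly increasing,
  so the \<open>j\<close>-th angle belongs to the \<open>j\<close>-th eigenvalue.\<close>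

lemma lap_theta_properties:
  assumes "0 < Re \<alpha>" "Re \<alpha> < 1" "n \<ge> 3" "1 \<le> j" "j \<le> n"
  defines "\<theta> \<equiv> lap_theta \<alpha> n j"
  shows "lap_eigenvalue \<alpha> n j = g \<theta>" "(real j - 1) * pi / n \<le> \<theta>" "\<theta> < pi"
    "odd j \<Longrightarrow> \<theta> = (real j - 1) * pi / n" "even j \<Longrightarrow> secular \<alpha> n \<theta> = 0"
proof -
  have "\<forall>j\<in>{1..n}. \<exists>t. (real j - 1) * pi / n \<le> t \<and> t < real j * pi / n \<and>
      (if odd j then t = (real j - 1) * pi / n else secular \<alpha> n t = 0)"
  proof
    fix j assume "j \<in> {1..n}"
    then show "\<exists>t. (real j - 1) * pi / n \<le> t \<and> t < real j * pi / n \<and>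
        (if odd j then t = (real j - 1) * pi / n else secular \<alpha> n t = 0)"
      using assms by (intro trig_angles_exist) auto
  qed
  then obtain t where "\<forall>j\<in>{1..n}. (real j - 1) * pi / n \<le> t j \<and> t j < real j * pi / n \<and>
      (if odd j then t j = (real j - 1) * pi / n else secular \<alpha> n (t j) = 0)"
    by (rule bchoice[THEN exE])
  then have lower: "(real j - 1) * pi / n \<le> t j" and upper: "t j < real j * pi / n"
    and t_odd: "odd j \<Longrightarrow> t j = (real j - 1) * pi / n" and t_even: "even j \<Longrightarrow> secular \<alpha> n (t j) = 0"
    if "1 \<le> j" "j \<le> n" for j
    using that by auto
  have n: "real n > 0" using assms(3) by simp
  have t_pi: "t j < pi" if "1 \<le> j" "j \<le> n" for j
  proof -
    have "real j * pi / n \<le> pi" using that n by (simp add: field_simps)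
    with upper[OF that] show ?thesis by simp
  qed
  have t_nonneg: "0 \<le> t j" if "1 \<le> j" "j \<le> n" for j
  proof -
    have "0 \<le> (real j - 1) * pi / n" using that n by simp
    with lower[OF that] show ?thesis by simp
  qed
  have t_mono: "t i < t j" if "1 \<le> i" "i < j" "j \<le> n" for i j
  proof -
    have "real i * pi / n \<le> (real j - 1) * pi / n"
      using that n by (intro divide_right_mono mult_right_mono) auto
    with upper[of i] lower[of j] that show ?thesis by linarith
  qed
  have t_pos: "0 < t j" if "2 \<le> j" "j \<le> n" for j
    using t_mono[of 1 j] t_nonneg[of 1] that assms(3) by simp
  have t_1: "t 1 = 0" using t_odd[of 1] assms(3) by simp
  have g_mono: "g (t i) < g (t j)" if "1 \<le> i" "i < j" "j \<le> n" for i j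
    using that t_mono t_nonneg[of i] t_pi[of j] by (intro g_strict_mono) auto
  define xs where "xs = map (\<lambda>i. g (t (Suc i))) [0..<n]"
  have xs: "lap_eigenvalues \<alpha> n = xs"
  proof (rule lap_eigenvalues_eqI)
    have "sorted_wrt (<) xs"
      unfolding xs_def sorted_wrt_map
      by (rule sorted_wrt_mono_rel[OF _ sorted_wrt_upt]) (auto intro!: g_mono)
    then show "sorted xs" "distinct xs" by (simp_all add: strict_sorted_iff)
    show "length xs = n" by (simp add: xs_def)
    fix x assume "x \<in> set xs"
    then obtain i where i: "i < n" "x = g (t (Suc i))" by (auto simp: xs_def)
    show "eigenvalue (lap_mat \<alpha> n) (of_real x)"
    proof (cases "i = 0")
      \<comment> \<open>At the angle \<open>t 1 = 0\<close> the ansatz is the zero vector, so the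
        constant vector supplies this eigenvalue.\<close>
      case True
      then show ?thesis
        using eigenvector_ones[OF assms(3)] i t_1 by (auto simp: eigenvalue_def g_def)
    next
      case False
      let ?j = "Suc i"
      have j: "2 \<le> ?j" "?j \<le> n" using False i by auto
      have "sin (real n * t ?j / 2) * secular \<alpha> n (t ?j) = 0"
      proof (cases "odd ?j")
        case True
        then obtain m where "i = 2 * m" by auto
        then have "real n * t ?j / 2 = real m * pi" using t_odd[of ?j] True j n by simp
        then show ?thesis by simp
      qed (use t_even[of ?j] j in auto)
      then show ?thesis
        using eigenvector_trig_entry[OF assms(1-3) t_pos[OF j]] t_pi[of ?j] j i
        by (auto simp: eigenvalue_def)
    qed
  qed
  have ev: "lap_eigenvalue \<alpha> n j = g (t j)"
  proof -
    have "Suc (j - 1) = j" "[0..<n] ! (j - 1) = j - 1" using assms(4,5) by auto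
    moreover have "j - 1 < length [0..<n]" using assms(4,5) by auto
    ultimately show ?thesis by (simp only: lap_eigenvalue_def xs xs_def nth_map)
  qed
  have \<theta>: "\<theta> = t j"
    unfolding \<theta>_def using t_nonneg t_pi assms(4,5) ev by (intro lap_theta_eqI) (auto intro: less_imp_le)
  show "lap_eigenvalue \<alpha> n j = g \<theta>" "(real j - 1) * pi / n \<le> \<theta>" "\<theta> < pi"
    "odd j \<Longrightarrow> \<theta> = (real j - 1) * pi / n" "even j \<Longrightarrow> secular \<alpha> n \<theta> = 0"
    unfolding \<theta> using ev lower t_pi t_odd t_even assms(4,5) by auto
qed

lemma eigvec_eq: "eigvec \<alpha> n j = vec n (\<lambda>k. trig_entry \<alpha> n (lap_theta \<alpha> n j) (real (k + 1)))"
  by (simp add: eigvec_def eigvec_entry_def trig_entry_def add.commute)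

section \<open>Wave decomposition and the mean square\<close>

text \<open>A geometric sum in closed form, multiplied by \<open>sin t\<close> to avoid a
  division.\<close>

lemma sin_mult_sum_cis:
  "of_real (sin t) * (\<Sum>k=1..n. cis (2 * real k * t)) = of_real (sin (real n * t)) * cis ((real n + 1) * t)"
proof (induction n)
  case (Suc n)
  define a where "a = (real n + 1) * t"
  have e: "2 * real (Suc n) * t = a + a" "real (Suc n) * t = a" "(real (Suc n) + 1) * t = a + t"
    by (simp_all add: a_def algebra_simps)
  have "real n * t = a - t" by (simp add: a_def algebra_simps)
  then have step: "of_real (sin (real n * t)) + of_real (sin t) * cis a = of_real (sin a) * cis t"
    by (simp only: sin_diff) (simp add: complex_eq_iff)
  have "of_real (sin t) * (\<Sum>k=1..Suc n. cis (2 * real k * t))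
      = of_real (sin t) * (\<Sum>k=1..n. cis (2 * real k * t)) + of_real (sin t) * cis (a + a)"
    by (simp add: distrib_left flip: e(1))
  also have "\<dots> = (of_real (sin (real n * t)) + of_real (sin t) * cis a) * cis a"
    unfolding Suc a_def[symmetric] cis_mult[symmetric] by (simp add: algebra_simps)
  also have "\<dots> = of_real (sin a) * cis (a + t)"
    unfolding step cis_mult[symmetric] by (simp add: mult_ac)
  finally show ?case unfolding e .
qed simp

text \<open>Up to the factor \<open>- 1 / (2 * \<i>)\<close> this is the coefficient of
  \<open>cis (- (x * t))\<close> in \<open>trig_entry\<close>; its value at \<open>- t\<close>
  belongs to \<open>cis (x * t)\<close>.\<close>

definition wave_coeff :: "complex \<Rightarrow> nat \<Rightarrow> real \<Rightarrow> complex" where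
  "wave_coeff \<alpha> n t = 1 - (1 - cnj \<alpha>) * cis t - cnj \<alpha> * cis (real n * t)"

definition mean_square :: "complex \<Rightarrow> nat \<Rightarrow> real \<Rightarrow> real" where
  "mean_square \<alpha> n t = ((cmod (wave_coeff \<alpha> n t))\<^sup>2 + (cmod (wave_coeff \<alpha> n (- t)))\<^sup>2) / 4"

lemma trig_entry_wave:
  "trig_entry \<alpha> n t x = (wave_coeff \<alpha> n (- t) * cis (x * t) - wave_coeff \<alpha> n t * cis (- (x * t))) / (2 * \<i>)"
proof -
  have s: "complex_of_real (sin y) = (cis y - cis (- y)) / (2 * \<i>)" for y
    by (simp add: complex_eq_iff)
  have e: "(x - 1) * t = x * t + - t" "(real n - x) * t = real n * t + - (x * t)"
    "- (x * t + - t) = - (x * t) + t" "- (real n * t + - (x * t)) = real n * (- t) + x * t"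
    by (simp_all add: algebra_simps)
  show ?thesis
    unfolding trig_entry_def wave_coeff_def s e cis_mult[symmetric]
    by (simp add: field_simps)
qed

text \<open>Only the cross term depends on \<open>x\<close>; it oscillates at double frequency,
  which is what \<open>sin_mult_sum_cis\<close> sums.\<close>

lemma cmod_wave_square:
  "(cmod (u * cis x - w * cis (- x)))\<^sup>2 = (cmod u)\<^sup>2 + (cmod w)\<^sup>2 - 2 * Re (u * cnj w * cis (2 * x))"
proof -
  have "complex_of_real ((cmod (u * cis x - w * cis (- x)))\<^sup>2)
      = (u * cis x - w * cis (- x)) * (cnj u * cis (- x) - cnj w * cis x)"
    by (simp only: complex_norm_square) (simp add: cis_cnj)
  also have "\<dots> = u * cnj u * (cis x * cis (- x)) + w * cnj w * (cis x * cis (- x))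
      - (u * cnj w * (cis x * cis x) + cnj u * w * (cis (- x) * cis (- x)))"
    by (simp add: algebra_simps)
  also have "\<dots> = u * cnj u + w * cnj w - (u * cnj w * cis (2 * x) + cnj (u * cnj w * cis (2 * x)))"
    by (simp add: cis_mult cis_cnj)
  also have "\<dots> = of_real ((cmod u)\<^sup>2 + (cmod w)\<^sup>2 - 2 * Re (u * cnj w * cis (2 * x)))"
    by (simp only: complex_add_cnj of_real_diff of_real_add flip: complex_norm_square)
  finally show ?thesis by (simp only: of_real_eq_iff)
qed

lemma norm2_trig_entry_bound:
  "\<bar>(norm2 (vec n (\<lambda>k. trig_entry \<alpha> n t (real (k + 1)))))\<^sup>2 - real n * mean_square \<alpha> n t\<bar> * \<bar>sin t\<bar>
    \<le> \<bar>sin (real n * t)\<bar> * mean_square \<alpha> n t"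
proof -
  define u w where "u = wave_coeff \<alpha> n (- t)" and "w = wave_coeff \<alpha> n t"
  define S where "S = (\<Sum>k=1..n. cis (2 * real k * t))"
  have "(norm2 (vec n (\<lambda>k. trig_entry \<alpha> n t (real (k + 1)))))\<^sup>2 = (\<Sum>k<n. (cmod (trig_entry \<alpha> n t (real (k + 1))))\<^sup>2)"
    by (simp add: norm2_def L2_set_def sum_nonneg)
  also have "\<dots> = (\<Sum>k=1..n. (cmod (trig_entry \<alpha> n t k))\<^sup>2)"
    by (rule sum.reindex_bij_witness[of _ "\<lambda>k. k - 1" "\<lambda>k. k + 1"]) auto
  also have "\<dots> = (\<Sum>k=1..n. mean_square \<alpha> n t - Re (u * cnj w * cis (2 * real k * t)) / 2)"
    unfolding trig_entry_wave norm_divide power_divide cmod_wave_square mean_square_def u_def w_def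
    by (intro sum.cong) (auto simp: norm_mult field_simps)
  also have "\<dots> = real n * mean_square \<alpha> n t - Re (u * cnj w * S) / 2"
    by (simp only: sum_subtractf S_def sum_distrib_left Re_sum sum_divide_distrib sum_constant card_atLeastAtMost) simp
  finally have diff: "(norm2 (vec n (\<lambda>k. trig_entry \<alpha> n t (real (k + 1)))))\<^sup>2
      = real n * mean_square \<alpha> n t - Re (u * cnj w * S) / 2" .
  have eq: "\<bar>(norm2 (vec n (\<lambda>k. trig_entry \<alpha> n t (real (k + 1)))))\<^sup>2 - real n * mean_square \<alpha> n t\<bar>
      = \<bar>Re (u * cnj w * S)\<bar> / 2" unfolding diff by simp
  have "cmod (of_real (sin t) * S) = cmod (of_real (sin (real n * t)) * cis ((real n + 1) * t))"
    unfolding S_def sin_mult_sum_cis ..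
  then have S: "\<bar>sin t\<bar> * cmod S = \<bar>sin (real n * t)\<bar>" by (simp add: norm_mult)
  have "\<bar>Re (u * cnj w * S)\<bar> \<le> cmod u * cmod w * cmod S"
    using abs_Re_le_cmod[of "u * cnj w * S"] by (simp add: norm_mult)
  then have "\<bar>Re (u * cnj w * S)\<bar> / 2 * \<bar>sin t\<bar> \<le> cmod u * cmod w * cmod S / 2 * \<bar>sin t\<bar>"
    by (intro mult_right_mono) auto
  also have "\<dots> = cmod u * cmod w / 2 * \<bar>sin (real n * t)\<bar>"
    by (simp flip: S)
  \<comment> \<open>The bound \<open>2 * |u| * |w| \<le> |u|^2 + |w|^2\<close> makes the error
    proportional to the mean square.\<close>
  also have "\<dots> \<le> mean_square \<alpha> n t * \<bar>sin (real n * t)\<bar>"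
    using sum_squares_bound[of "cmod u" "cmod w"]
    by (intro mult_right_mono) (auto simp: mean_square_def u_def w_def mult_ac)
  finally show ?thesis unfolding eq by (simp only: mult.commute)
qed

lemma mean_square_eq:
  "mean_square \<alpha> n t = 1 - Re \<alpha> + (cmod \<alpha>)\<^sup>2 - (1 - Re \<alpha>) * cos t - Re \<alpha> * cos (real n * t)
     + (Re \<alpha> - (cmod \<alpha>)\<^sup>2) * (cos (real n * t) * cos t + sin (real n * t) * sin t)"
proof -
  \<comment> \<open>Here \<open>r\<close>, \<open>b\<close> stand for the real and imaginary parts
    of \<alpha>, \<open>s\<close>, \<open>c\<close> for sine and cosine of \<open>t\<close>, and
    \<open>S\<close>, \<open>C\<close> for those of \<open>n * t\<close>. The first line is the
    coefficient at \<open>t\<close>, the second the one at \<open>- t\<close>.\<close>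
  have "(1 - ((1 - r) * c - b * s) - (r * C + b * S))\<^sup>2 + (- ((1 - r) * s + b * c) - (r * S - b * C))\<^sup>2
      + ((1 - ((1 - r) * c + b * s) - (r * C - b * S))\<^sup>2 + (((1 - r) * s - b * c) - (- (r * S) - b * C))\<^sup>2)
    = 4 * (1 - r + (r\<^sup>2 + b\<^sup>2) - (1 - r) * c - r * C + (r - (r\<^sup>2 + b\<^sup>2)) * (C * c + S * s))"
    (is "?lhs = ?rhs") if "s\<^sup>2 + c\<^sup>2 = 1" "S\<^sup>2 + C\<^sup>2 = 1" for r b s c S C :: real
  proof -
    have "?lhs = 2 * (1 + ((1 - r)\<^sup>2 + b\<^sup>2) * (s\<^sup>2 + c\<^sup>2) + (r\<^sup>2 + b\<^sup>2) * (S\<^sup>2 + C\<^sup>2))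
        - 4 * (1 - r) * c - 4 * r * C + 4 * (r - (r\<^sup>2 + b\<^sup>2)) * (C * c + S * s)"
      by (simp add: power2_eq_square algebra_simps)
    also have "\<dots> = ?rhs"
      unfolding that by (simp add: power2_eq_square algebra_simps)
    finally show ?thesis .
  qed
  from this[of "sin t" "cos t" "sin (real n * t)" "cos (real n * t)" "Re \<alpha>" "Im \<alpha>"]
  have "4 * mean_square \<alpha> n t = 4 * (1 - Re \<alpha> + (cmod \<alpha>)\<^sup>2 - (1 - Re \<alpha>) * cos t
      - Re \<alpha> * cos (real n * t)
      + (Re \<alpha> - (cmod \<alpha>)\<^sup>2) * (cos (real n * t) * cos t + sin (real n * t) * sin t))"
    by (simp add: mean_square_def wave_coeff_def cmod_power2)
  then show ?thesis by simp
qed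

lemma mean_square_nonneg: "0 \<le> mean_square \<alpha> n t"
  by (simp add: mean_square_def)

lemma sqrt_mean_square_le: "sqrt (mean_square \<alpha> n t) \<le> 2 * (1 + cmod \<alpha>)"
proof (rule real_le_lsqrt)
  have "cmod (wave_coeff \<alpha> n s) \<le> 2 * (1 + cmod \<alpha>)" for s
  proof -
    have "cmod (wave_coeff \<alpha> n s) \<le> cmod 1 + cmod ((1 - cnj \<alpha>) * cis s) + cmod (cnj \<alpha> * cis (real n * s))"
      unfolding wave_coeff_def by (meson add_right_mono norm_triangle_ineq4 order_trans)
    also have "\<dots> \<le> 1 + (1 + cmod \<alpha>) + cmod \<alpha>"
      using norm_triangle_ineq4[of 1 "cnj \<alpha>"] by (simp add: norm_mult)
    finally show ?thesis by simp
  qed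
  then have "(cmod (wave_coeff \<alpha> n s))\<^sup>2 \<le> (2 * (1 + cmod \<alpha>))\<^sup>2" for s
    by (intro power_mono) auto
  moreover have "(x + y) / 4 \<le> b" if "x \<le> b" "y \<le> b" "0 \<le> b" for x y b :: real
    using that by simp
  ultimately show "mean_square \<alpha> n t \<le> (2 * (1 + cmod \<alpha>))\<^sup>2"
    unfolding mean_square_def by (simp only: zero_le_power2)
qed simp

section \<open>Norms for odd and even indices\<close>

lemma norm2_trig_entry_odd:
  assumes "cis (real n * t) = 1" "sin t \<noteq> 0"
  shows "norm2 (vec n (\<lambda>k. trig_entry \<alpha> n t (real (k + 1)))) = cmod (1 - \<alpha>) * sqrt (real n / 2 * g t)"
proof -
  let ?N = "norm2 (vec n (\<lambda>k. trig_entry \<alpha> n t (real (k + 1))))"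
  have nt: "sin (real n * t) = 0" "cos (real n * t) = 1" using assms(1) by (auto simp: complex_eq_iff)
  have "?N\<^sup>2 = real n * mean_square \<alpha> n t"
    using norm2_trig_entry_bound[of n \<alpha> t] assms(2) nt by (simp add: mult_le_0_iff)
  also have "mean_square \<alpha> n t = (cmod (1 - \<alpha>))\<^sup>2 * (g t / 2)"
    unfolding mean_square_eq nt cmod_power2 g_def by (simp add: power2_eq_square field_simps)
  finally have "?N\<^sup>2 = (cmod (1 - \<alpha>))\<^sup>2 * (real n / 2 * g t)" by simp
  then have "?N = sqrt ((cmod (1 - \<alpha>))\<^sup>2 * (real n / 2 * g t))"
    by (metis L2_set_nonneg norm2_def real_sqrt_unique)
  then show ?thesis by (simp only: real_sqrt_mult real_sqrt_abs abs_norm_cancel)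
qed

text \<open>A zero means \<open>cot (n * t / 2) = - tan (eta \<alpha> t / 2)\<close>, so
  \<open>n * t\<close> is \<open>eta \<alpha> t + pi\<close> modulo \<open>2 * pi\<close>. All
  quantities are rational in \<open>z = tan (eta \<alpha> t / 2)\<close>.\<close>

lemma secular_zeroD:
  assumes "0 < Re \<alpha>" "Re \<alpha> < 1" "0 < t" "t < pi" "secular \<alpha> n t = 0"
  shows "cos (real n * t) = - cos (eta \<alpha> t)" "sin (real n * t) = - sin (eta \<alpha> t)"
    and "\<bar>sin (real n * t)\<bar> * (Re \<alpha> * (1 - Re \<alpha>)) \<le> \<bar>sin t\<bar>"
proof -
  define r s c where "r = Re \<alpha>" and "s = sin (t / 2)" and "c = cos (t / 2)"
  define C S where "C = cos (real n * t / 2)" and "S = sin (real n * t / 2)"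
  have pos: "0 < r" "r < 1" "0 < s" "0 < c"
    using assms by (auto simp: r_def s_def c_def intro!: sin_gt_zero cos_gt_zero_pi)
  define z where "z = kappa \<alpha> * cot (t / 2)"
  have z: "z = r * c / ((1 - r) * s)" by (simp add: z_def kappa_def cot_def r_def s_def c_def)
  have C: "C = - z * S"
    using assms(5) pos unfolding secular_def z
    unfolding r_def[symmetric] s_def[symmetric] c_def[symmetric] C_def[symmetric] S_def[symmetric]
    by (simp add: field_simps)
  have "C\<^sup>2 + S\<^sup>2 = 1" by (simp add: C_def S_def)
  then have "S\<^sup>2 * (1 + z\<^sup>2) = 1"
    unfolding C by (simp add: algebra_simps power2_eq_square)
  moreover have zp: "1 + z\<^sup>2 > 0" by (simp add: add_pos_nonneg)
  ultimately have S: "S\<^sup>2 = 1 / (1 + z\<^sup>2)" by (simp add: eq_divide_eq)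
  have eta: "eta \<alpha> t = 2 * arctan z" using assms(3) by (simp add: eta_def z_def)
  have "(cos (arctan z))\<^sup>2 = 1 / (1 + z\<^sup>2)" "(sin (arctan z))\<^sup>2 = z\<^sup>2 / (1 + z\<^sup>2)"
    "sin (arctan z) * cos (arctan z) = z / (1 + z\<^sup>2)"
    unfolding cos_arctan sin_arctan using zp by (simp_all add: power_divide)
  then have ce: "cos (eta \<alpha> t) = (1 - z\<^sup>2) / (1 + z\<^sup>2)" and se: "sin (eta \<alpha> t) = 2 * z / (1 + z\<^sup>2)"
    unfolding eta cos_double sin_double by (simp_all add: diff_divide_distrib)
  have "cos (real n * t) = C\<^sup>2 - S\<^sup>2" "sin (real n * t) = 2 * S * C"
    using cos_double[of "real n * t / 2"] sin_double[of "real n * t / 2"] by (simp_all add: C_def S_def)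
  then have cn: "cos (real n * t) = S\<^sup>2 * (z\<^sup>2 - 1)" and sn: "sin (real n * t) = - (S\<^sup>2 * (2 * z))"
    unfolding C by (simp_all add: algebra_simps power2_eq_square)
  show "cos (real n * t) = - cos (eta \<alpha> t)" "sin (real n * t) = - sin (eta \<alpha> t)"
  proof -
    have "(z\<^sup>2 - 1) / (1 + z\<^sup>2) = - ((1 - z\<^sup>2) / (1 + z\<^sup>2))"
      by (metis minus_diff_eq minus_divide_left)
    then show "cos (real n * t) = - cos (eta \<alpha> t)" "sin (real n * t) = - sin (eta \<alpha> t)"
      unfolding cn sn ce se S by simp_all
  qed
  \<comment> \<open>This is \<open>1 + z\<^sup>2\<close> with its denominator cleared.\<close>
  define D where "D = ((1 - r) * s)\<^sup>2 + (r * c)\<^sup>2"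
  have Dpos: "0 < D" using pos by (simp add: D_def add_pos_nonneg)
  have z2: "S\<^sup>2 * z = r * (1 - r) * (s * c) / D"
  proof -
    have "1 + z\<^sup>2 = D / ((1 - r) * s)\<^sup>2"
      unfolding D_def add_divide_distrib z power_divide using pos by simp
    then have "S\<^sup>2 * z = ((1 - r) * s)\<^sup>2 / D * (r * c / ((1 - r) * s))"
      by (simp add: S z)
    also have "\<dots> = r * (1 - r) * (s * c) / D"
      using pos by (simp add: power2_eq_square)
    finally show ?thesis .
  qed
  have st: "sin t = 2 * s * c" using sin_double[of "t / 2"] by (simp add: s_def c_def)
  have abs: "\<bar>sin (real n * t)\<bar> = r * (1 - r) * sin t / D"
  proof -
    have "\<bar>sin (real n * t)\<bar> = 2 * \<bar>S\<^sup>2 * z\<bar>" unfolding sn by (simp add: abs_mult)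
    also have "\<dots> = 2 * (r * (1 - r) * (s * c) / D)" unfolding z2 using pos Dpos by simp
    finally show ?thesis by (simp add: st)
  qed
  \<comment> \<open>A lower bound for \<open>D\<close> independent of \<open>t\<close>, since
    \<open>r\<close> and \<open>1 - r\<close> are at most 1.\<close>
  have "(r * (1 - r))\<^sup>2 = (r * (1 - r))\<^sup>2 * (s\<^sup>2 + c\<^sup>2)" by (simp add: s_def c_def)
  also have "\<dots> = r\<^sup>2 * ((1 - r) * s)\<^sup>2 + (1 - r)\<^sup>2 * (r * c)\<^sup>2"
    unfolding power_mult_distrib by (simp only: distrib_left mult_ac)
  also have "\<dots> \<le> 1 * ((1 - r) * s)\<^sup>2 + 1 * (r * c)\<^sup>2"
    using pos by (intro add_mono mult_right_mono power_le_one) auto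
  finally have "(r * (1 - r))\<^sup>2 \<le> D" by (simp add: D_def)
  then have "sin t * ((r * (1 - r))\<^sup>2 / D) \<le> sin t * 1"
    using Dpos st pos by (intro mult_left_mono) auto
  then show "\<bar>sin (real n * t)\<bar> * (Re \<alpha> * (1 - Re \<alpha>)) \<le> \<bar>sin t\<bar>"
    unfolding abs r_def[symmetric] using st pos by (simp add: power2_eq_square mult_ac)
qed

lemma norm2_trig_entry_even:
  assumes "0 < Re \<alpha>" "Re \<alpha> < 1" "0 < t" "t < pi" "secular \<alpha> n t = 0" "n > 0"
  shows "\<bar>norm2 (vec n (\<lambda>k. trig_entry \<alpha> n t (real (k + 1)))) - sqrt (real n * nu \<alpha> t)\<bar>
    \<le> 2 * (1 + cmod \<alpha>) / (Re \<alpha> * (1 - Re \<alpha>)) / sqrt (real n)"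
proof -
  let ?N = "norm2 (vec n (\<lambda>k. trig_entry \<alpha> n t (real (k + 1))))"
  define K where "K = Re \<alpha> * (1 - Re \<alpha>)"
  define M where "M = mean_square \<alpha> n t"
  have K: "K > 0" using assms by (simp add: K_def)
  have M: "M \<ge> 0" by (simp add: M_def mean_square_nonneg)
  \<comment> \<open>Replacing \<open>n * t\<close> by \<open>eta \<alpha> t\<close> flips the signs
    of its sine and cosine, which matches \<open>mean_square_eq\<close> with
    \<open>nu\<close>.\<close>
  have nu: "nu \<alpha> t = M"
    unfolding M_def mean_square_eq secular_zeroD[OF assms(1-5)] nu_def g_def cos_diff
    by (simp add: algebra_simps add_divide_distrib diff_divide_distrib)
  have st: "sin t > 0" using assms by (simp add: sin_gt_zero)
  have "\<bar>?N\<^sup>2 - real n * M\<bar> * \<bar>sin t\<bar> * K \<le> \<bar>sin (real n * t)\<bar> * M * K"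
    unfolding M_def using K by (intro mult_right_mono norm2_trig_entry_bound) auto
  also have "\<dots> = (\<bar>sin (real n * t)\<bar> * K) * M" by simp
  also have "\<dots> \<le> \<bar>sin t\<bar> * M"
    using secular_zeroD(3)[OF assms(1-5)] M unfolding K_def by (rule mult_right_mono)
  finally have sq: "\<bar>?N\<^sup>2 - real n * M\<bar> * K \<le> M" using st by (simp add: mult_ac)
  have N: "?N \<ge> 0" by (simp add: norm2_def)
  \<comment> \<open>The difference of squares is divided by \<open>?N + sqrt (n * M)\<close>, which
    is at least \<open>sqrt (n * M)\<close>. This cancels a factor \<open>sqrt M\<close>, so
    \<open>M = 0\<close> is treated apart.\<close>
  have "\<bar>?N - sqrt (real n * M)\<bar> * sqrt (real n) * K \<le> sqrt M"
  proof (cases "M = 0")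
    case True
    then have "?N\<^sup>2 * K \<le> 0" using sq by simp
    then have "?N = 0" using K by (simp add: mult_le_0_iff)
    then show ?thesis using True by simp
  next
    case False
    then have "sqrt M > 0" using M by simp
    have "(\<bar>?N - sqrt (real n * M)\<bar> * sqrt (real n) * K) * sqrt M
        = \<bar>?N - sqrt (real n * M)\<bar> * sqrt (real n * M) * K" by (simp add: real_sqrt_mult)
    also have "\<dots> \<le> \<bar>?N - sqrt (real n * M)\<bar> * (?N + sqrt (real n * M)) * K"
      using N K by (intro mult_right_mono mult_left_mono) auto
    also have "\<dots> = \<bar>(?N - sqrt (real n * M)) * (?N + sqrt (real n * M))\<bar> * K"
      using N M by (simp add: abs_mult)
    also have "(?N - sqrt (real n * M)) * (?N + sqrt (real n * M)) = ?N\<^sup>2 - real n * M"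
      using M by (simp add: algebra_simps power2_eq_square)
    also have "\<bar>?N\<^sup>2 - real n * M\<bar> * K \<le> sqrt M * sqrt M" using sq M by simp
    finally show ?thesis by (rule mult_right_le_imp_le) (rule \<open>sqrt M > 0\<close>)
  qed
  also have "\<dots> \<le> 2 * (1 + cmod \<alpha>)" unfolding M_def by (rule sqrt_mean_square_le)
  finally show ?thesis
    using K assms(6) unfolding nu K_def[symmetric] by (simp add: field_simps)
qed

theorem theorem5:
  fixes \<alpha> :: complex
  assumes "0 < Re \<alpha>" and "Re \<alpha> < 1"
  shows "(\<forall>n\<ge>3.
            lap_eigenvalue \<alpha> n 1 = 0 \<and>
            eigenvector (lap_mat \<alpha> n) (vec n (\<lambda>k. 1)) (complex_of_real (lap_eigenvalue \<alpha> n 1)) \<and>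
            (\<forall>j\<in>{2..n}.
               eigenvector (lap_mat \<alpha> n) (eigvec \<alpha> n j) (complex_of_real (lap_eigenvalue \<alpha> n j)) \<and>
               (odd j \<longrightarrow>
                  norm2 (eigvec \<alpha> n j) = cmod (1 - \<alpha>) * sqrt (real n / 2 * lap_eigenvalue \<alpha> n j)))) \<and>
         (\<exists>C>0. \<forall>n\<ge>3. \<forall>j\<in>{2..n}. even j \<longrightarrow>
            \<bar>norm2 (eigvec \<alpha> n j) - sqrt (real n * nu \<alpha> (lap_theta \<alpha> n j))\<bar> \<le> C / sqrt (real n))"
proof -
  have pos: "0 < lap_theta \<alpha> n j" if "n \<ge> 3" "j \<in> {2..n}" for n j
  proof -
    have "0 < (real j - 1) * pi / n" using that by auto
    also have "\<dots> \<le> lap_theta \<alpha> n j"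
      using that by (intro lap_theta_properties(2) assms) auto
    finally show ?thesis .
  qed
  have odd_cis: "cis (real n * lap_theta \<alpha> n j) = 1" if "n \<ge> 3" "j \<in> {2..n}" "odd j" for n j
  proof -
    obtain m where "j = 2 * m + 1" using \<open>odd j\<close> by (elim oddE)
    then have "real n * lap_theta \<alpha> n j = real m * (2 * pi)"
      using lap_theta_properties(4)[OF assms that(1), of j] that by simp
    then show ?thesis using cis_multiple_2pi[of "real m"] by (simp add: mult.commute)
  qed
  have first: "lap_eigenvalue \<alpha> n 1 = 0" if "n \<ge> 3" for n
    using lap_theta_properties(1,4)[OF assms that, of 1] that by (simp add: g_def)
  have eigen: "eigenvector (lap_mat \<alpha> n) (eigvec \<alpha> n j) (complex_of_real (lap_eigenvalue \<alpha> n j))"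
    if nj: "n \<ge> 3" "j \<in> {2..n}" for n j
  proof -
    have j: "1 \<le> j" "j \<le> n" using nj by auto
    note th = lap_theta_properties[OF assms nj(1) j]
    have "sin (real n * lap_theta \<alpha> n j / 2) * secular \<alpha> n (lap_theta \<alpha> n j) = 0"
    proof (cases "odd j")
      case True
      then obtain m where "j = 2 * m + 1" by (elim oddE)
      then have "real n * lap_theta \<alpha> n j / 2 = real m * pi" using th(4) nj by simp
      then show ?thesis by simp
    qed (use th(5) in simp)
    then show ?thesis
      unfolding th(1) eigvec_eq by (intro eigenvector_trig_entry assms nj pos th)
  qed
  have odd_norm: "norm2 (eigvec \<alpha> n j) = cmod (1 - \<alpha>) * sqrt (real n / 2 * lap_eigenvalue \<alpha> n j)"
    if nj: "n \<ge> 3" "j \<in> {2..n}" "odd j" for n j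
  proof -
    have j: "1 \<le> j" "j \<le> n" using nj by auto
    note th = lap_theta_properties[OF assms nj(1) j]
    have "sin (lap_theta \<alpha> n j) \<noteq> 0" using sin_gt_zero[OF pos[OF nj(1,2)] th(3)] by simp
    then show ?thesis unfolding th(1) eigvec_eq by (intro norm2_trig_entry_odd odd_cis nj)
  qed
  \<comment> \<open>The numerator bounds \<open>sqrt (mean_square \<alpha> n t)\<close>; the
    denominator comes from the bound on \<open>sin (n * t)\<close> in
    \<open>secular_zeroD\<close>.\<close>
  define C where "C = 2 * (1 + cmod \<alpha>) / (Re \<alpha> * (1 - Re \<alpha>))"
  have "C > 0" unfolding C_def using assms by (intro divide_pos_pos mult_pos_pos) (auto simp: add_pos_nonneg)
  moreover have "\<bar>norm2 (eigvec \<alpha> n j) - sqrt (real n * nu \<alpha> (lap_theta \<alpha> n j))\<bar> \<le> C / sqrt (real n)"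
    if nj: "n \<ge> 3" "j \<in> {2..n}" "even j" for n j
  proof -
    have j: "1 \<le> j" "j \<le> n" using nj by auto
    note th = lap_theta_properties[OF assms nj(1) j]
    show ?thesis
      unfolding eigvec_eq C_def using nj
      by (intro norm2_trig_entry_even assms pos th) auto
  qed
  ultimately show ?thesis using first eigen odd_norm eigenvector_ones by auto
qed

end
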